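(* Let $K$ be a field and let $I\subset K[x_1,\ldots,x_n]$ be a proper equigenerated monomial ideal. Let $(h_0,h_1,h_2,\ldots)$ be the $h$-vector of the fiber ring $F(I)$. Then $h_2\geq 0$.
   Context: A monomial ideal is equigenerated if it is generated by monomials all of the same degree. With $\mathfrak{m}=(x_1,\ldots,x_n)$, the fiber ring of $I$ is the standard graded $K$-algebra $F(I)=\bigoplus_{k\geq 0}I^k/\mathfrak{m}I^k$, and the analytic spread $\ell(I)$ is the Krull dimension of $F(I)$. The Hilbert series of $F(I)$ has the form $Q(t)/(1-t)^{\ell(I)}$ with $Q(t)=\sum_{i\geq 0}h_it^i$ a polynomial with integer coefficients and $h_0=1$; $(h_0,h_1,\ldots)$ is called the $h$-vector of $F(I)$. *)

theory Defs
  imports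
    "HOL-Library.Poly_Mapping"
    "HOL-Library.Extended_Nat"
    "HOL-Computational_Algebra.Computational_Algebra"
    "HOL-Algebra.Algebra"
    "HOL-Algebra.Algebraic_Closure_Type"
begin

text \<open>
  The polynomial ring \<open>K[x\<^sub>1, \<dots>, x\<^sub>n]\<close> is the monoid algebra of the exponent vectors
  \<^typ>\<open>'n \<Rightarrow>\<^sub>0 nat\<close> over the field \<^typ>\<open>'a\<close>; the variables are the elements of the finite type
  \<^typ>\<open>'n\<close>, so \<open>n = CARD('n)\<close>.
\<close>

type_synonym ('n, 'a) mpoly = "('n \<Rightarrow>\<^sub>0 nat) \<Rightarrow>\<^sub>0 'a"

abbreviation mpoly_ring :: "('n::finite, 'a::field) mpoly ring" where
  "mpoly_ring \<equiv> ring_of_type_algebra"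

definition monomial :: "('n::finite \<Rightarrow>\<^sub>0 nat) \<Rightarrow> ('n, 'a::field) mpoly" where
  "monomial a = Poly_Mapping.single a 1"

definition mon_degree :: "('n::finite \<Rightarrow>\<^sub>0 nat) \<Rightarrow> nat" where
  "mon_degree a = (\<Sum>i\<in>UNIV. Poly_Mapping.lookup a i)"

definition variable :: "'n::finite \<Rightarrow> ('n, 'a::field) mpoly" where
  "variable i = monomial (Poly_Mapping.single i 1)"

definition max_ideal :: "('n::finite, 'a::field) mpoly set" where
  "max_ideal = Idl\<^bsub>mpoly_ring\<^esub> (range variable)"

text \<open>The zero ideal is included, with empty generating set.\<close>

definition equigenerated_monomial_ideal :: "('n::finite, 'a::field) mpoly set \<Rightarrow> bool" where
  "equigenerated_monomial_ideal I \<longleftrightarrow>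
     (\<exists>d A. (\<forall>a\<in>A. mon_degree a = d) \<and> I = Idl\<^bsub>mpoly_ring\<^esub> (monomial ` A))"

definition ideal_power :: "('n::finite, 'a::field) mpoly set \<Rightarrow> nat \<Rightarrow> ('n, 'a) mpoly set" where
  "ideal_power I k = I [^]\<^bsub>ideals_set mpoly_ring\<^esub> k"

text \<open>
  The graded ring \<open>\<Oplus>\<^sub>k I\<^sup>k / \<mm>I\<^sup>k\<close> is represented as the quotient of \<open>\<Oplus>\<^sub>k I\<^sup>k t\<^sup>k\<close>, a subring of
  \<open>K[x\<^sub>1, \<dots>, x\<^sub>n][t]\<close>, by its ideal \<open>\<Oplus>\<^sub>k \<mm>I\<^sup>k t\<^sup>k\<close>.
\<close>

definition rees_ring :: "('n::finite, 'a::field) mpoly set \<Rightarrow> ('n, 'a) mpoly poly ring" where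
  "rees_ring I = ring_of_type_algebra \<lparr>carrier := {p. \<forall>k. Polynomial.coeff p k \<in> ideal_power I k}\<rparr>"

definition fiber_ideal :: "('n::finite, 'a::field) mpoly set \<Rightarrow> ('n, 'a) mpoly poly set" where
  "fiber_ideal I = {p. \<forall>k. Polynomial.coeff p k \<in> max_ideal \<cdot>\<^bsub>mpoly_ring\<^esub> ideal_power I k}"

definition fiber_ring :: "('n::finite, 'a::field) mpoly set \<Rightarrow> ('n, 'a) mpoly poly set ring" where
  "fiber_ring I = rees_ring I Quot fiber_ideal I"

definition fiber_component ::
    "('n::finite, 'a::field) mpoly set \<Rightarrow> nat \<Rightarrow> ('n, 'a) mpoly poly set set" where
  "fiber_component I k = (\<lambda>f. fiber_ideal I +>\<^bsub>rees_ring I\<^esub> Polynomial.monom f k) ` ideal_power I k"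

text \<open>The image of the field of constants in the fiber ring.\<close>

definition fiber_scalars ::
    "('n::finite, 'a::field) mpoly set \<Rightarrow> ('n, 'a) mpoly poly set set" where
  "fiber_scalars I =
     range (\<lambda>c. fiber_ideal I +>\<^bsub>rees_ring I\<^esub> Polynomial.monom (Poly_Mapping.single 0 c) 0)"

definition hilbert_function :: "('n::finite, 'a::field) mpoly set \<Rightarrow> nat \<Rightarrow> nat" where
  "hilbert_function I k = ring.dim (fiber_ring I) (fiber_scalars I) (fiber_component I k)"

definition hilbert_series :: "('n::finite, 'a::field) mpoly set \<Rightarrow> int fps" where
  "hilbert_series I = Abs_fps (\<lambda>k. int (hilbert_function I k))"

text \<open>
  The supremum of the lengths \<open>d\<close> of chains \<open>P\<^sub>0 \<subset> \<dots> \<subset> P\<^sub>d\<close> of prime ideals.  The value for the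
  zero ring, which has no prime ideals, is \<open>0\<close>.
\<close>

definition krull_dim :: "('b, 'c) ring_scheme \<Rightarrow> enat" where
  "krull_dim R =
     (SUP d \<in> {d. \<exists>P :: nat \<Rightarrow> 'b set.
         (\<forall>i\<le>d. primeideal (P i) R) \<and> (\<forall>i<d. P i \<subset> P (Suc i))}. enat d)"

definition analytic_spread :: "('n::finite, 'a::field) mpoly set \<Rightarrow> nat" where
  "analytic_spread I = the_enat (krull_dim (fiber_ring I))"

text \<open>
  If the Hilbert series is \<open>Q(t) / (1 - t)\<^sup>\<ell>\<close>, where \<open>\<ell>\<close> is the analytic spread, then \<open>Q\<close> is its
  product with \<open>(1 - t)\<^sup>\<ell>\<close>.  That product is taken in the ring of formal power series, so the
  definition does not presuppose the theorem that it is a polynomial.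
\<close>

definition h_vector :: "('n::finite, 'a::field) mpoly set \<Rightarrow> nat \<Rightarrow> int" where
  "h_vector I i = fps_nth ((1 - fps_X) ^ analytic_spread I * hilbert_series I) i"

end

theory Submission
  imports
    Defs
    "HOL-Library.Set_Algebras"
    "HOL-Analysis.Finite_Cartesian_Product"
    "HOL-Analysis.Linear_Algebra"
begin

text \<open>
Let \<open>A\<close> be the set of exponent vectors of the generators, all of degree \<open>d\<close>, and let \<open>k A\<close> denote its
\<open>k\<close>-fold sumset.  Every exponent of a monomial in \<open>I\<^sup>k\<close> either lies in \<open>k A\<close> and has degree \<open>d k\<close>, or
has larger degree, and then the monomial lies in \<open>\<mm>I\<^sup>k\<close>.  Hence the monomials with exponents in
\<open>k A\<close> form a basis of \<open>I\<^sup>k / \<mm>I\<^sup>k\<close>, and the Hilbert function of the fiber ring is the growth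
function \<open>k \<mapsto> |k A|\<close> (\<open>hilbert_function_eq\<close>).  With \<open>\<ell>\<close> the analytic spread,
\<open>h\<^sub>2 = |A + A| - \<ell> |A| + (\<ell> choose 2)\<close>.

Let \<open>r\<close> be the dimension of the real span of \<open>A\<close>.  Freiman's lemma (\<open>freiman_lemma\<close>) gives
\<open>|A + A| \<ge> r |A| - (r choose 2)\<close>, which is the claim for \<open>\<ell> = r\<close>.  The claim follows from this
whenever \<open>\<ell> \<le> r\<close>: the difference of the values for \<open>\<ell> + 1\<close> and \<open>\<ell>\<close> in the formula for \<open>h\<^sub>2\<close> is
\<open>\<ell> - |A|\<close>, so for \<open>\<ell> \<le> r \<le> |A|\<close> the formula only grows when \<open>\<ell>\<close> becomes smaller
(\<open>freiman_defect_antimono\<close>).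

The bound \<open>\<ell> \<le> r\<close> (\<open>analytic_spread_le_rank\<close>) is a comparison of growth rates.  Given a
chain of \<open>D + 1\<close> primes, one element chosen from each step of the chain gives \<open>D\<close> elements that
are algebraically independent modulo the smallest prime (\<open>independent_mod_prime_chain\<close>), so the
\<open>(k + 1)\<^sup>D\<close> power products with exponents up to \<open>k\<close> are linearly independent in the fiber ring.
They live in degrees \<open>O(k)\<close>.  On the other hand, \<open>r\<close> suitable coordinates determine a vector of the
span of \<open>A\<close>, so the part of the fiber ring in degrees \<open>O(k)\<close> has dimension \<open>O(k\<^sup>r)\<close>.  Therefore
\<open>D \<le> r\<close>.
\<close>

section \<open>Freiman's lemma on sumsets\<close>

lemma inner_less_of_norm_le:
  fixes v y :: "'v::real_inner"
  assumes "norm y \<le> norm v" and "y \<noteq> v"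
  shows "inner v y < inner v v"
proof -
  have "0 < inner (v - y) (v - y)" using assms(2) by simp
  moreover have "inner y y \<le> inner v v" using assms(1) by (simp add: norm_le)
  ultimately show ?thesis by (simp add: inner_diff inner_commute)
qed

text \<open>
The new sums in \<open>A + A\<close> that appear when an element \<open>v\<close> of maximal norm is added to \<open>A - {v}\<close> are the
\<open>v + x\<close> with \<open>x\<close> in the set on the right.  If \<open>v + x = y + z\<close> is not new, then \<open>y\<close> and \<open>z\<close> have a
larger inner product with \<open>v\<close> than \<open>x\<close> has, because both of their inner products are below that of \<open>v\<close>
itself.  By induction \<open>y\<close> and \<open>z\<close> are in the span, and so is \<open>x = y + z - v\<close>.
\<close>

lemma span_irreducible_sums:
  fixes A :: "'v::real_inner set"
  assumes fin: "finite A" and v: "v \<in> A" and max: "\<And>y. y \<in> A \<Longrightarrow> norm y \<le> norm v"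
  shows "A \<subseteq> span {x \<in> A. v + x \<notin> (A - {v}) + (A - {v})}" (is "_ \<subseteq> span ?S")
proof
  fix x assume "x \<in> A"
  then show "x \<in> span ?S"
  proof (induction "card {y \<in> A. inner v x < inner v y}" arbitrary: x rule: less_induct)
    case less
    show ?case
    proof (cases "x \<in> ?S")
      case False
      then obtain y z where yz: "y \<in> A - {v}" "z \<in> A - {v}" "v + x = y + z"
        using less.prems unfolding set_plus_def by blast
      have "inner v y < inner v v" "inner v z < inner v v"
        using yz max by (auto intro: inner_less_of_norm_le)
      moreover have "inner v v + inner v x = inner v y + inner v z"
        using yz(3) by (metis inner_add_right)
      ultimately have gt: "inner v x < inner v y" "inner v x < inner v z" by linarith+
      have "w \<in> span ?S" if "w \<in> A" "inner v x < inner v w" for w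
      proof (rule less.hyps)
        show "card {y \<in> A. inner v w < inner v y} < card {y \<in> A. inner v x < inner v y}"
          using that fin by (intro psubset_card_mono) auto
      qed fact
      then have "y \<in> span ?S" "z \<in> span ?S" using gt yz by auto
      \<comment> \<open>\<open>v + v\<close> is always new: the inner products of \<open>y\<close> and \<open>z\<close> with \<open>v\<close> are too small.\<close>
      moreover have "v \<in> span ?S"
      proof (rule span_base)
        show "v \<in> ?S"
        proof -
          have "v + v \<noteq> y + z" if "y \<in> A - {v}" "z \<in> A - {v}" for y z
          proof
            assume "v + v = y + z"
            then have "inner v v + inner v v = inner v y + inner v z" by (metis inner_add_right)
            moreover have "inner v y < inner v v" "inner v z < inner v v"
              using that max by (auto intro: inner_less_of_norm_le)
            ultimately show False by linarith
          qed
          then show ?thesis using v unfolding set_plus_def by blast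
        qed
      qed
      moreover have "x = y + z - v" using yz(3) by (metis add_diff_cancel_left')
      ultimately show ?thesis by (simp add: span_add span_diff)
    qed (simp add: span_base)
  qed
qed

text \<open>
Induction on the size of \<open>A\<close>, removing an element \<open>v\<close> of maximal norm.  If \<open>v\<close> is in the span of the
rest, the dimension stays the same and at least \<open>dim A\<close> sums are new by the previous lemma.
Otherwise every \<open>v + x\<close> with \<open>x \<in> A\<close> is new, which makes up for the drop of the dimension by one.
\<close>

theorem freiman_lemma:
  fixes A :: "'v::euclidean_space set"
  assumes "finite A"
  shows "dim A * card A \<le> card (A + A) + (dim A choose 2)"
  using assms
proof (induction "card A" arbitrary: A)
  case 0
  then show ?case by simp
next
  case (Suc n)
  have "A \<noteq> {}" using Suc.hyps by auto
  then obtain v where v: "v \<in> A" and max: "\<And>y. y \<in> A \<Longrightarrow> norm y \<le> norm v"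
    using Suc.prems Max_in[of "norm ` A"] Max_ge[of "norm ` A"] by fastforce
  define B where "B = A - {v}"
  have A: "A = insert v B" "v \<notin> B" using v by (auto simp: B_def)
  have finB: "finite B" using Suc.prems by (simp add: B_def)
  have cardA: "card A = Suc (card B)" using A finB by simp
  have IH: "dim B * card B \<le> card (B + B) + (dim B choose 2)"
    using Suc.hyps finB cardA by simp
  have fin2: "finite (A + A)" "finite (B + B)"
    using Suc.prems finB by (auto intro: finite_set_plus)
  show ?case
  proof (cases "v \<in> span B")
    case True
    define S where "S = {x \<in> A. v + x \<notin> B + B}"
    have "A \<subseteq> span S"
      using span_irreducible_sums[OF Suc.prems v max] unfolding S_def B_def by blast
    then have "dim A \<le> card S"
      using Suc.prems by (intro dim_le_card) (auto simp: S_def)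
    moreover have "card S + card (B + B) \<le> card (A + A)"
    proof -
      have "card S = card ((+) v ` S)" by (simp add: card_image)
      moreover have "(+) v ` S \<inter> (B + B) = {}" by (auto simp: S_def)
      moreover have "(+) v ` S \<union> (B + B) \<subseteq> A + A"
        using v by (auto simp: S_def set_plus_def A)
      ultimately show ?thesis
        by (metis card_Un_disjoint card_mono fin2 finite_Un finite_subset)
    qed
    moreover have dimAB: "dim A = dim B" using True by (simp add: A(1) dim_insert)
    moreover have "dim B * card A = dim B + dim B * card B" by (simp add: cardA)
    ultimately show ?thesis using IH unfolding dimAB by linarith
  next
    case False
    then have dim: "dim A = Suc (dim B)" by (simp add: A(1) dim_insert)
    have "v + x \<noteq> y + z" if "x \<in> A" "y \<in> B" "z \<in> B" for x y z
    proof
      assume eq: "v + x = y + z"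
      show False
      proof (cases "x = v")
        case True
        then have "v = (1/2) *\<^sub>R (y + z)"
          using eq by (metis scaleR_half_double)
        then show False using False that by (metis span_add span_base span_mul)
      next
        case False
        then have "x \<in> span B" using that A by (auto intro: span_base)
        moreover have "v = y + z - x" using eq by (metis add_diff_cancel_right')
        ultimately show False using \<open>v \<notin> span B\<close> that by (metis span_add span_base span_diff)
      qed
    qed
    then have "(+) v ` A \<inter> (B + B) = {}" by (auto simp: set_plus_def)
    moreover have "(+) v ` A \<union> (B + B) \<subseteq> A + A"
      using v by (auto simp: set_plus_def A)
    moreover have "card A = card ((+) v ` A)" by (simp add: card_image)
    ultimately have "card A + card (B + B) \<le> card (A + A)"
      by (metis card_Un_disjoint card_mono fin2 finite_Un finite_subset)
    moreover have "(Suc (dim B) choose 2) = (dim B choose 2) + dim B"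
      by (simp add: numeral_2_eq_2)
    ultimately show ?thesis using IH by (simp add: cardA dim)
  qed
qed

section \<open>Linear algebra over a field\<close>

text \<open>
A minimal set \<open>J\<close> of coordinates that separates the points of \<open>V\<close> has at most \<open>dim V\<close> elements: for
each \<open>j \<in> J\<close>, minimality provides a vector of \<open>V\<close> whose only nonzero coordinate in \<open>J\<close> is the one at
\<open>j\<close>, and these vectors are linearly independent.
\<close>

lemma coordinates_determining_subspace:
  fixes V :: "(real^'n) set"
  assumes "subspace V"
  obtains J where "card J \<le> dim V" "\<And>x. x \<in> V \<Longrightarrow> (\<And>j. j \<in> J \<Longrightarrow> x $ j = 0) \<Longrightarrow> x = 0"
proof -
  define sep where "sep J \<longleftrightarrow> (\<forall>x\<in>V. (\<forall>j\<in>J. x $ j = 0) \<longrightarrow> x = 0)" for J :: "'n set"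
  have "sep UNIV" by (simp add: sep_def vec_eq_iff)
  then obtain J where J: "sep J" and min: "\<And>J'. sep J' \<Longrightarrow> card J \<le> card J'"
    using exists_least_iff[of "\<lambda>k. \<exists>J. sep J \<and> card J = k"]
    by (metis (mono_tags, lifting) not_le_imp_less)
  have "\<exists>x\<in>V. x $ j \<noteq> 0 \<and> (\<forall>i\<in>J - {j}. x $ i = 0)" if "j \<in> J" for j
  proof -
    have "card (J - {j}) < card J" using that by (intro psubset_card_mono) auto
    then have "\<not> sep (J - {j})" using min by (meson not_le)
    then obtain x where x: "x \<in> V" "\<forall>i\<in>J - {j}. x $ i = 0" "x \<noteq> 0" by (auto simp: sep_def)
    then have "x $ j \<noteq> 0" using J by (auto simp: sep_def)
    then show ?thesis using x by blast
  qed
  then obtain b where b: "\<And>j. j \<in> J \<Longrightarrow> b j \<in> V" "\<And>j. j \<in> J \<Longrightarrow> b j $ j \<noteq> 0"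
    "\<And>i j. j \<in> J \<Longrightarrow> i \<in> J \<Longrightarrow> i \<noteq> j \<Longrightarrow> b j $ i = 0" by (metis Diff_iff singletonD)
  have inj: "inj_on b J" by (rule inj_onI) (metis b(2,3))
  have "independent (b ` J)"
  proof (rule independent_if_scalars_zero)
    fix f x assume f: "(\<Sum>x\<in>b ` J. f x *\<^sub>R x) = 0" and "x \<in> b ` J"
    then obtain j where j: "j \<in> J" "x = b j" by auto
    have "0 = (\<Sum>x\<in>b ` J. f x *\<^sub>R x) $ j" using f by simp
    also have "\<dots> = (\<Sum>i\<in>J. f (b i) * b i $ j)"
      by (simp add: sum.reindex[OF inj])
    also have "\<dots> = (\<Sum>i\<in>J. if i = j then f (b j) * b j $ j else 0)"
      using b j by (intro sum.cong) auto
    also have "\<dots> = f (b j) * b j $ j" using j by simp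
    finally show "f x = 0" using b(2) j by simp
  qed simp
  moreover have "b ` J \<subseteq> V" using b by auto
  ultimately have "card (b ` J) \<le> dim V" by (metis dim_eq_card_independent dim_subset)
  then have "card J \<le> dim V" using inj by (simp add: card_image)
  then show thesis using that J by (auto simp: sep_def)
qed

text \<open>
Gaussian elimination: an equation \<open>b\<close> in which the unknown \<open>e0\<close> occurs is used to eliminate \<open>e0\<close>
from the remaining equations.
\<close>

lemma homogeneous_system_nontrivial_solution:
  fixes f :: "'e \<Rightarrow> 'b \<Rightarrow> 'a::field"
  assumes "finite B" and "finite E" and "card B < card E"
  obtains c where "\<exists>e\<in>E. c e \<noteq> 0" and "\<And>b. b \<in> B \<Longrightarrow> (\<Sum>e\<in>E. c e * f e b) = 0"
proof -
  have "\<exists>c. (\<exists>e\<in>E. c e \<noteq> 0) \<and> (\<forall>b\<in>B. (\<Sum>e\<in>E. c e * f e b) = 0)"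
    using assms
  proof (induction B arbitrary: E f rule: finite_induct)
    case empty
    then have "E \<noteq> {}" by auto
    then show ?case by (intro exI[of _ "\<lambda>_. 1"]) auto
  next
    case (insert b B)
    show ?case
    proof (cases "\<forall>e\<in>E. f e b = 0")
      case True
      have "card B < card E" using insert.prems insert.hyps by simp
      then obtain c where "\<exists>e\<in>E. c e \<noteq> 0" "\<forall>b\<in>B. (\<Sum>e\<in>E. c e * f e b) = 0"
        using insert.IH insert.prems(1) by blast
      then show ?thesis using True by (intro exI[of _ c]) auto
    next
      case False
      then obtain e0 where e0: "e0 \<in> E" "f e0 b \<noteq> 0" by auto
      define g where "g e b' = f e b' - f e b / f e0 b * f e0 b'" for e b'
      have "card B < card (E - {e0})" using insert.prems insert.hyps e0 by simp
      then obtain c where c: "\<exists>e\<in>E - {e0}. c e \<noteq> 0" "\<forall>b\<in>B. (\<Sum>e\<in>E - {e0}. c e * g e b) = 0"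
        using insert.IH[of "E - {e0}" g] insert.prems(1) by auto
      define c' where "c' = c(e0 := - (\<Sum>e\<in>E - {e0}. c e * f e b / f e0 b))"
      have c'_sum: "(\<Sum>e\<in>E. c' e * f e b') = (\<Sum>e\<in>E - {e0}. c e * g e b')" for b'
      proof -
        have "(\<Sum>e\<in>E. c' e * f e b') = c' e0 * f e0 b' + (\<Sum>e\<in>E - {e0}. c' e * f e b')"
          using e0 insert.prems(1) by (simp add: sum.remove)
        also have "(\<Sum>e\<in>E - {e0}. c' e * f e b') = (\<Sum>e\<in>E - {e0}. c e * f e b')"
          by (intro sum.cong) (auto simp: c'_def)
        finally show ?thesis
          by (simp add: c'_def g_def sum_distrib_right right_diff_distrib sum_subtractf mult.assoc)
      qed
      have "(\<Sum>e\<in>E. c' e * f e b') = 0" if "b' \<in> insert b B" for b'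
      proof (cases "b' = b")
        case True
        then show ?thesis unfolding c'_sum using e0(2) by (simp add: g_def)
      next
        case False
        then show ?thesis unfolding c'_sum using that c(2) by simp
      qed
      moreover have "\<exists>e\<in>E. c' e \<noteq> 0" using c(1) by (auto simp: c'_def)
      ultimately show ?thesis by blast
    qed
  qed
  then show thesis using that by blast
qed

section \<open>Power products along a chain of primes\<close>

lemma ring_of_type_algebra_simps [simp]:
  "carrier (ring_of_type_algebra :: 'b::comm_ring_1 ring) = UNIV"
  "x \<otimes>\<^bsub>ring_of_type_algebra\<^esub> y = x * (y :: 'b)"
  "x \<oplus>\<^bsub>ring_of_type_algebra\<^esub> y = x + (y :: 'b)"
  "\<one>\<^bsub>ring_of_type_algebra\<^esub> = (1 :: 'b)"
  "\<zero>\<^bsub>ring_of_type_algebra\<^esub> = (0 :: 'b)"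
  by (simp_all add: ring_of_type_algebra_def)

text \<open>
The exponents of \<open>D\<close> variables are lists of length \<open>D\<close>, so that the variable belonging to the lowest
step of a chain of primes can be split off as the head.
\<close>

definition exponent_lists :: "nat \<Rightarrow> nat \<Rightarrow> nat list set" where
  "exponent_lists D k = {es. set es \<subseteq> {..k} \<and> length es = D}"

lemma finite_exponent_lists: "finite (exponent_lists D k)"
  unfolding exponent_lists_def by (rule finite_lists_length_eq) simp

lemma card_exponent_lists: "card (exponent_lists D k) = Suc k ^ D"
  unfolding exponent_lists_def by (subst card_lists_length_eq) simp_all

lemma exponent_lists_0 [simp]: "exponent_lists 0 k = {[]}"
  by (auto simp: exponent_lists_def)

lemma exponent_lists_Suc: "exponent_lists (Suc D) k = (\<lambda>(j, es). j # es) ` ({..k} \<times> exponent_lists D k)"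
  by (auto simp: exponent_lists_def length_Suc_conv image_iff)

definition power_product :: "(nat \<Rightarrow> 'b::comm_ring_1) \<Rightarrow> nat list \<Rightarrow> 'b" where
  "power_product x es = (\<Prod>i<length es. x i ^ (es ! i))"

lemma power_product_Nil [simp]: "power_product x [] = 1"
  by (simp add: power_product_def)

lemma power_product_Cons: "power_product x (j # es) = x 0 ^ j * power_product (\<lambda>i. x (Suc i)) es"
  by (simp add: power_product_def prod.lessThan_Suc_shift del: prod.lessThan_Suc)

text \<open>
Group the sum by the exponent \<open>j\<close> of \<open>x 0\<close>, with coefficients \<open>G j\<close>, and let \<open>m\<close> be the least \<open>j\<close> that
has a nonzero \<open>c\<close>.  Then \<open>x 0 ^ m\<close> is a common factor; as \<open>x 0\<close> lies outside the prime \<open>P 0\<close>,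
it can be cancelled modulo \<open>P 0\<close>, which leaves \<open>G m\<close> plus a multiple of \<open>x 0\<close>.  Both \<open>P 0\<close> and \<open>x 0\<close>
are contained in \<open>P 1\<close>, so \<open>G m \<in> P 1\<close>, and the shorter chain starting at \<open>P 1\<close> shows that all
coefficients of \<open>G m\<close> vanish, a contradiction.
\<close>

lemma independent_mod_prime_chain:
  fixes C :: "'b::comm_ring_1 set"
  defines "R \<equiv> (ring_of_type_algebra \<lparr>carrier := C\<rparr> :: 'b ring)"
  assumes prime: "\<And>i. i \<le> D \<Longrightarrow> primeideal (P i) R"
    and chain: "\<And>i. i < D \<Longrightarrow> P i \<subseteq> P (Suc i)"
    and x: "\<And>i. i < D \<Longrightarrow> x i \<in> P (Suc i) - P i"
    and c: "\<And>es. c es \<in> C" "\<And>es. c es \<in> P D \<Longrightarrow> c es = 0"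
    and sum: "(\<Sum>es\<in>exponent_lists D k. c es * power_product x es) \<in> P 0"
    and es: "es \<in> exponent_lists D k"
  shows "c es = 0"
  using prime chain x c sum es
proof (induction D arbitrary: P x c es)
  case 0
  then show ?case by simp
next
  case (Suc D)
  define y where "y i = x (Suc i)" for i
  define G where "G j = (\<Sum>es\<in>exponent_lists D k. c (j # es) * power_product y es)" for j
  interpret P0: primeideal "P 0" R using Suc.prems(1) by simp
  interpret P1: primeideal "P 1" R using Suc.prems(1)[of 1] by simp
  have ops [simp]: "carrier R = C" "a \<otimes>\<^bsub>R\<^esub> b = a * b" "a \<oplus>\<^bsub>R\<^esub> b = a + b" "\<one>\<^bsub>R\<^esub> = 1" "\<zero>\<^bsub>R\<^esub> = 0" for a b
    by (simp_all add: R_def)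
  have C_mult: "a * b \<in> C" if "a \<in> C" "b \<in> C" for a b
    using P0.m_closed that by simp
  have C_add: "a + b \<in> C" if "a \<in> C" "b \<in> C" for a b
    using P0.add.m_closed that by simp
  have C_1: "1 \<in> C" and C_0: "0 \<in> C" using P0.one_closed P0.zero_closed by simp_all
  have C_minus: "- a \<in> C" if "a \<in> C" for a
  proof -
    have "\<ominus>\<^bsub>R\<^esub> a = - a"
    proof -
      have "a + \<ominus>\<^bsub>R\<^esub> a = 0" using P0.r_neg[of a] that by simp
      then show ?thesis by (simp add: eq_neg_iff_add_eq_0 add.commute)
    qed
    then show ?thesis using P0.a_inv_closed[of a] that by simp
  qed
  have C_power: "a ^ n \<in> C" if "a \<in> C" for a n
    using that by (induction n) (auto intro: C_mult C_1)
  have C_sum: "(\<And>i. i \<in> W \<Longrightarrow> g i \<in> C) \<Longrightarrow> sum g W \<in> C" for g and W :: "'z set"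
    by (induction W rule: infinite_finite_induct) (auto intro: C_add C_0)
  have C_prod: "(\<And>i. i \<in> W \<Longrightarrow> g i \<in> C) \<Longrightarrow> prod g W \<in> C" for g and W :: "'z set"
    by (induction W rule: infinite_finite_induct) (auto intro: C_mult C_1)
  have x_C: "x i \<in> C" if "i < Suc D" for i
  proof -
    interpret Q: primeideal "P (Suc i)" R using Suc.prems(1) that by simp
    show ?thesis using Q.a_subset Suc.prems(3)[OF that] by auto
  qed
  have G_C: "G j \<in> C" for j
  proof -
    have "power_product y es \<in> C" if "es \<in> exponent_lists D k" for es
      unfolding power_product_def
      using that by (intro C_prod C_power) (auto simp: y_def exponent_lists_def intro!: x_C)
    then show ?thesis unfolding G_def by (intro C_sum C_mult Suc.prems(4))
  qed
  have total: "(\<Sum>es\<in>exponent_lists (Suc D) k. c es * power_product x es) = (\<Sum>j\<le>k. x 0 ^ j * G j)"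
  proof -
    have "inj_on (\<lambda>(j, es). j # es) ({..k} \<times> exponent_lists D k)" by (auto simp: inj_on_def)
    then have "(\<Sum>es\<in>exponent_lists (Suc D) k. c es * power_product x es) =
        (\<Sum>(j, es)\<in>{..k} \<times> exponent_lists D k. c (j # es) * power_product x (j # es))"
      unfolding exponent_lists_Suc by (simp add: sum.reindex case_prod_unfold)
    also have "\<dots> = (\<Sum>j\<le>k. \<Sum>es\<in>exponent_lists D k. c (j # es) * power_product x (j # es))"
      by (rule sum.cartesian_product[symmetric])
    also have "\<dots> = (\<Sum>j\<le>k. x 0 ^ j * G j)"
      by (simp add: G_def sum_distrib_left power_product_Cons y_def[abs_def] mult_ac)
    finally show ?thesis .
  qed
  show ?case
  proof (rule ccontr)
    assume "c es \<noteq> 0"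
    define bad where "bad j \<longleftrightarrow> (\<exists>es\<in>exponent_lists D k. c (j # es) \<noteq> 0)" for j
    obtain j' es' where "es = j' # es'" "j' \<le> k" "es' \<in> exponent_lists D k"
      using Suc.prems(7) unfolding exponent_lists_Suc by auto
    then have bad': "bad j'" using \<open>c es \<noteq> 0\<close> by (auto simp: bad_def)
    define m where "m = (LEAST j. bad j)"
    have "bad m" unfolding m_def using bad' by (rule LeastI)
    have "m \<le> k" using Least_le[of bad, OF bad'] \<open>j' \<le> k\<close> by (simp add: m_def)
    have G_0: "G j = 0" if "j < m" for j
      using not_less_Least[of j bad] that by (auto simp: m_def bad_def G_def)
    define H where "H = (\<Sum>j\<in>{Suc m..k}. x 0 ^ (j - Suc m) * G j)"
    have H_C: "H \<in> C" unfolding H_def using x_C G_C by (intro C_sum C_mult C_power) auto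
    have "(\<Sum>j\<le>k. x 0 ^ j * G j) = (\<Sum>j\<in>{m..k}. x 0 ^ j * G j)"
      using G_0 by (intro sum.mono_neutral_right) auto
    also have "\<dots> = x 0 ^ m * G m + (\<Sum>j\<in>{Suc m..k}. x 0 ^ j * G j)"
      using \<open>m \<le> k\<close> by (simp add: sum.atLeast_Suc_atMost)
    also have "(\<Sum>j\<in>{Suc m..k}. x 0 ^ j * G j) = x 0 ^ m * (x 0 * H)"
      unfolding H_def sum_distrib_left
      by (intro sum.cong) (auto simp flip: power_add power_Suc simp: mult.assoc[symmetric])
    finally have "x 0 ^ m * (G m + x 0 * H) \<in> P 0"
      using Suc.prems(6) total by (simp add: distrib_left)
    moreover have x0: "x 0 \<in> C" "x 0 \<in> P 1" "x 0 \<notin> P 0" using x_C Suc.prems(3)[of 0] by auto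
    have "b \<in> P 0" if "x 0 ^ n * b \<in> P 0" "b \<in> C" for b n
      using that
    proof (induction n)
      case (Suc n)
      have "x 0 \<in> P 0 \<or> x 0 ^ n * b \<in> P 0"
        using P0.I_prime[of "x 0" "x 0 ^ n * b"] Suc.prems x0 by (simp add: C_mult C_power mult.assoc)
      then show ?case using Suc x0 by blast
    qed simp
    ultimately have "G m + x 0 * H \<in> P 0" by (simp add: C_add C_mult G_C H_C x0)
    then have "G m + x 0 * H \<in> P 1" using Suc.prems(2)[of 0] by auto
    moreover have "(- H) * x 0 \<in> P 1"
      using P1.I_l_closed[OF x0(2), of "- H"] C_minus[OF H_C] by simp
    ultimately have "(G m + x 0 * H) + (- H) * x 0 \<in> P 1"
      using P1.a_closed by fastforce
    then have "G m \<in> P 1" by (simp add: mult.commute)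
    have "c (m # es) = 0" if "es \<in> exponent_lists D k" for es
    proof (rule Suc.IH[where P = "\<lambda>i. P (Suc i)" and x = y and c = "\<lambda>es. c (m # es)"])
      show "(\<Sum>es\<in>exponent_lists D k. c (m # es) * power_product y es) \<in> P (Suc 0)"
        using \<open>G m \<in> P 1\<close> by (simp add: G_def)
    qed (use Suc.prems that in \<open>auto simp: y_def\<close>)
    then show False using \<open>bad m\<close> by (auto simp: bad_def)
  qed
qed

lemma power_growth_exponent_le:
  assumes "\<And>k. Suc k ^ D \<le> Suc (m * k) ^ r"
  shows "D \<le> r"
proof (rule ccontr)
  assume "\<not> D \<le> r"
  \<comment> \<open>For this \<open>k\<close> the right-hand side is at most \<open>((m + 1) (k + 1)) ^ r = k (k + 1) ^ r\<close>.\<close>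
  define k where "k = Suc m ^ r"
  have "Suc k ^ Suc r \<le> Suc k ^ D" using \<open>\<not> D \<le> r\<close> by (intro power_increasing) auto
  also have "\<dots> \<le> Suc (m * k) ^ r" by (rule assms)
  also have "\<dots> \<le> (Suc m * Suc k) ^ r" by (intro power_mono) auto
  also have "\<dots> = k * Suc k ^ r" by (simp only: power_mult_distrib k_def)
  finally have "Suc k * Suc k ^ r \<le> k * Suc k ^ r" by simp
  then show False by (simp only: mult_le_cancel2) simp
qed

section \<open>Ideals spanned by monomials\<close>

lemma a_inv_type_algebra [simp]: "\<ominus>\<^bsub>ring_of_type_algebra\<^esub> x = - (x :: 'b::comm_ring_1)"
proof -
  interpret cring "ring_of_type_algebra :: 'b ring" by (rule cring_from_type_algebra)
  show ?thesis by (rule minus_equality) simp_all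
qed

lemma ideal_ring_of_type_algebraI:
  fixes I :: "'b::comm_ring_1 set"
  assumes "0 \<in> I" "\<And>x y. x \<in> I \<Longrightarrow> y \<in> I \<Longrightarrow> x + y \<in> I" "\<And>x r. x \<in> I \<Longrightarrow> r * x \<in> I"
  shows "ideal I ring_of_type_algebra"
proof -
  interpret cring "ring_of_type_algebra :: 'b ring" by (rule cring_from_type_algebra)
  show ?thesis
  proof (rule idealI)
    show "subgroup I (add_monoid (ring_of_type_algebra :: 'b ring))"
    proof (rule add.subgroupI)
      show "\<ominus>\<^bsub>ring_of_type_algebra\<^esub> x \<in> I" if "x \<in> I" for x
        using assms(3)[OF that, of "-1"] by simp
    qed (use assms in auto)
  qed (use assms ring_axioms in \<open>auto simp: mult.commute\<close>)
qed

definition monomial_span :: "('n::finite \<Rightarrow>\<^sub>0 nat) set \<Rightarrow> ('n, 'a::field) mpoly set" where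
  "monomial_span U = {p. Poly_Mapping.keys p \<subseteq> U}"

lemma monomial_spanI:
  assumes "\<And>x. x \<in> Poly_Mapping.keys p \<Longrightarrow> x \<in> U"
  shows "p \<in> monomial_span U"
  using assms by (auto simp: monomial_span_def)

lemma monomial_span_add: "p \<in> monomial_span U \<Longrightarrow> q \<in> monomial_span U \<Longrightarrow> p + q \<in> monomial_span U"
  using keys_add[of p q] by (auto simp: monomial_span_def)

lemma monomial_span_0 [simp]: "0 \<in> monomial_span U"
  by (simp add: monomial_span_def)

lemma monomial_span_sum: "(\<And>x. x \<in> W \<Longrightarrow> f x \<in> monomial_span U) \<Longrightarrow> sum f W \<in> monomial_span U"
  by (induction W rule: infinite_finite_induct) (auto intro: monomial_span_add)

lemma monomial_span_mult:
  "p \<in> monomial_span U \<Longrightarrow> q \<in> monomial_span V \<Longrightarrow> p * q \<in> monomial_span (U + V)"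
  using keys_mult[of p q] unfolding monomial_span_def set_plus_def by blast

lemma monomial_span_UNIV [simp]: "monomial_span UNIV = UNIV"
  by (simp add: monomial_span_def)

lemma monomial_span_mono: "U \<subseteq> V \<Longrightarrow> monomial_span U \<subseteq> monomial_span V"
  by (auto simp: monomial_span_def)

lemma poly_mapping_eq_sum_single:
  "p = (\<Sum>a\<in>Poly_Mapping.keys p. Poly_Mapping.single a (Poly_Mapping.lookup p a))"
  by (rule poly_mapping_eqI)
     (simp add: lookup_sum lookup_single when_def in_keys_iff)

lemma lookup_const_mult:
  "Poly_Mapping.lookup (Poly_Mapping.single 0 c * p) b = c * Poly_Mapping.lookup (p :: ('n::finite, 'a::field) mpoly) b"
  unfolding mult_map_scale_conv_mult[symmetric] by (simp add: Poly_Mapping.map.rep_eq when_def)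

text \<open>
To show that a set of polynomials contains a monomial span, it is enough to look at the terms.
\<close>

lemma monomial_span_minimal:
  fixes J :: "('n::finite, 'a::field) mpoly set"
  assumes "\<And>a c. a \<in> U \<Longrightarrow> Poly_Mapping.single a c \<in> J" "0 \<in> J" "\<And>p q. p \<in> J \<Longrightarrow> q \<in> J \<Longrightarrow> p + q \<in> J"
  shows "monomial_span U \<subseteq> J"
proof
  fix p :: "('n, 'a) mpoly" assume p: "p \<in> monomial_span U"
  have *: "sum f W \<in> J" if "finite W" "\<And>x. x \<in> W \<Longrightarrow> f x \<in> J" for f :: "_ \<Rightarrow> ('n, 'a) mpoly" and W :: "('n \<Rightarrow>\<^sub>0 nat) set"
    using that by (induction W rule: finite_induct) (simp_all add: assms)
  then show "p \<in> J"
    using p assms(1) by (subst poly_mapping_eq_sum_single) (auto simp: monomial_span_def intro!: *)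
qed

lemma UNIV_plus_UNIV [simp]: "UNIV + UNIV = (UNIV :: 'b::monoid_add set)"
proof -
  have "x \<in> UNIV + UNIV" for x :: 'b
    using set_plus_intro[of x UNIV 0 UNIV] by simp
  then show ?thesis by blast
qed

text \<open>
All ideals that occur are spanned by monomials, so from here on ideals are replaced by their sets
of exponents, and products of ideals by sumsets.  The sum with \<^const>\<open>UNIV\<close> expresses that the
exponents of multiples of generators are included.
\<close>

lemma genideal_monomials:
  "Idl\<^bsub>mpoly_ring\<^esub> (monomial ` A) = (monomial_span (A + UNIV) :: ('n::finite, 'a::field) mpoly set)"
    (is "?L = ?R")
proof -
  interpret cring "mpoly_ring :: ('n, 'a) mpoly ring" by (rule cring_from_type_algebra)
  have "ideal ?R mpoly_ring"
  proof (rule ideal_ring_of_type_algebraI)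
    fix x r :: "('n, 'a) mpoly" assume "x \<in> ?R"
    then have "x * r \<in> monomial_span ((A + UNIV) + UNIV)"
      by (intro monomial_span_mult) simp_all
    then show "r * x \<in> ?R" by (simp add: add.assoc mult.commute)
  qed (auto intro: monomial_span_add)
  moreover have "monomial ` A \<subseteq> ?R"
  proof
    fix m :: "('n, 'a) mpoly" assume "m \<in> monomial ` A"
    then obtain a where "a \<in> A" "m = monomial a" by auto
    then show "m \<in> ?R"
      by (auto simp: monomial_def monomial_span_def set_plus_def intro!: bexI[of _ a] exI[of _ 0])
  qed
  ultimately have "?L \<subseteq> ?R" by (rule genideal_minimal)
  moreover have "?R \<subseteq> ?L"
  proof (rule monomial_span_minimal)
    have id: "ideal ?L mpoly_ring" by (rule genideal_ideal) simp
    then interpret L: ideal ?L "mpoly_ring :: ('n, 'a) mpoly ring" .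
    show "0 \<in> ?L" using L.zero_closed by simp
    show "p + q \<in> ?L" if "p \<in> ?L" "q \<in> ?L" for p q using L.a_closed[OF that] by simp
    fix u c assume "u \<in> A + UNIV"
    then obtain a b where ab: "a \<in> A" "u = a + b" by (auto simp: set_plus_def)
    then have "monomial a \<in> ?L" using genideal_self[of "monomial ` A"] by auto
    then have "Poly_Mapping.single b c * monomial a \<in> ?L"
      using L.I_l_closed by fastforce
    then show "Poly_Mapping.single u c \<in> ?L"
      by (simp add: monomial_def mult_single ab add.commute)
  qed
  ultimately show ?thesis by blast
qed

lemma ideal_prod_monomial_span:
  "monomial_span U \<cdot>\<^bsub>mpoly_ring\<^esub> monomial_span V = (monomial_span (U + V) :: ('n::finite, 'a::field) mpoly set)"
    (is "?L = ?R")
proof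
  show "?L \<subseteq> ?R"
  proof
    fix x assume "x \<in> ?L"
    then show "x \<in> ?R"
      by (induction rule: ideal_prod.induct) (simp_all add: monomial_span_mult monomial_span_add)
  qed
  show "?R \<subseteq> ?L"
  proof (rule monomial_span_minimal)
    have prod: "p * q \<in> ?L" if "p \<in> monomial_span U" "q \<in> monomial_span V" for p q :: "('n, 'a) mpoly"
      using ideal_prod.prod[OF that, of mpoly_ring] by simp
    show "0 \<in> ?L" using prod[of 0 0] by simp
    show "p + q \<in> ?L" if "p \<in> ?L" "q \<in> ?L" for p q using ideal_prod.sum[OF that] by simp
    fix w c assume "w \<in> U + V"
    then obtain u v where "u \<in> U" "v \<in> V" "w = u + v" by (auto simp: set_plus_def)
    then show "Poly_Mapping.single w c \<in> ?L"
      using prod[of "Poly_Mapping.single u c" "monomial v"]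
      by (simp add: monomial_def mult_single monomial_span_def)
  qed
qed

primrec sumset_power :: "('b::comm_monoid_add) set \<Rightarrow> nat \<Rightarrow> 'b set" where
  "sumset_power A 0 = {0}"
| "sumset_power A (Suc k) = sumset_power A k + A"

lemma ideal_power_eq:
  assumes "I = monomial_span (A + UNIV)"
  shows "ideal_power I k = monomial_span (sumset_power A k + UNIV)"
proof (induction k)
  case 0
  then show ?case by (simp add: ideal_power_def ideals_set_def)
next
  case (Suc k)
  have "ideal_power I (Suc k) = ideal_power I k \<cdot>\<^bsub>mpoly_ring\<^esub> I"
    by (simp add: ideal_power_def ideals_set_def nat_pow_def)
  also have "\<dots> = monomial_span ((sumset_power A k + UNIV) + (A + UNIV))"
    by (subst Suc.IH, subst assms, rule ideal_prod_monomial_span)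
  also have "(sumset_power A k + UNIV) + (A + UNIV) =
      ((sumset_power A k + A) + UNIV) + UNIV"
    by (simp only: add.assoc add.commute add.left_commute)
  finally show ?case by (simp add: add.assoc)
qed

lemma max_ideal_eq: "max_ideal = (monomial_span (- {0}) :: ('n::finite, 'a::field) mpoly set)"
proof -
  have "range variable = (monomial ` range (\<lambda>i. Poly_Mapping.single i 1) :: ('n, 'a) mpoly set)"
    by (simp add: variable_def[abs_def] image_image)
  moreover have "range (\<lambda>i::'n. Poly_Mapping.single i (1::nat)) + UNIV = - {0}"
  proof (intro equalityI subsetI)
    fix b :: "'n \<Rightarrow>\<^sub>0 nat" assume "b \<in> - {0}"
    then obtain i where "Poly_Mapping.lookup b i \<noteq> 0" by (metis ComplD singletonI lookup_zero poly_mapping_eqI)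
    then have "Poly_Mapping.single i 1 + (b - Poly_Mapping.single i 1) = b"
      by (intro poly_mapping_eqI) (auto simp: lookup_add lookup_minus lookup_single when_def)
    then show "b \<in> range (\<lambda>i::'n. Poly_Mapping.single i (1::nat)) + UNIV"
      by (metis UNIV_I rangeI set_plus_intro)
  next
    fix b assume "b \<in> range (\<lambda>i::'n. Poly_Mapping.single i (1::nat)) + UNIV"
    then obtain i c where "b = Poly_Mapping.single i 1 + c" by (auto simp: set_plus_def)
    then have "Poly_Mapping.lookup b i \<noteq> 0" by (simp add: lookup_add)
    then show "b \<in> - {0}" by auto
  qed
  ultimately show ?thesis by (simp add: max_ideal_def genideal_monomials)
qed

section \<open>The fiber ring and its Hilbert function\<close>

lemma sumset_power_add: "sumset_power A (i + j) = sumset_power A i + sumset_power A j"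
  by (induction j) (simp_all add: add.assoc)

lemma finite_sumset_power: "finite A \<Longrightarrow> finite (sumset_power A k)"
  by (induction k) (simp_all add: finite_set_plus)

lemma mon_degree_0 [simp]: "mon_degree 0 = 0"
  by (simp add: mon_degree_def)

lemma mon_degree_add: "mon_degree (a + b) = mon_degree a + mon_degree b"
  by (simp add: mon_degree_def lookup_add sum.distrib)

lemma mon_degree_eq_0_iff: "mon_degree a = 0 \<longleftrightarrow> a = 0"
proof
  assume "mon_degree a = 0"
  then show "a = 0" by (intro poly_mapping_eqI) (simp add: mon_degree_def)
qed simp

lemma keys_uminus: "Poly_Mapping.keys (- p) = Poly_Mapping.keys (p :: ('n::finite, 'a::field) mpoly)"
  by (auto simp: in_keys_iff)

text \<open>
The degree \<open>d\<close> may be \<open>0\<close>.  The bound on the analytic spread assumes \<open>d > 0\<close>, so that a monomial of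
degree \<open>d k\<close> determines \<open>k\<close>; this is where \<open>I \<noteq> UNIV\<close> enters, as \<open>d = 0\<close> and \<open>A \<noteq> {}\<close> would give the
unit ideal.
\<close>

locale equigenerated =
  fixes A :: "('n::finite \<Rightarrow>\<^sub>0 nat) set" and d :: nat and I :: "('n, 'a::field) mpoly set"
  assumes degree_generator: "\<And>a. a \<in> A \<Longrightarrow> mon_degree a = d"
    and I_eq: "I = monomial_span (A + UNIV)"
begin

text \<open>
\<open>S k + UNIV\<close> and \<open>N k\<close> are the sets of exponents of \<open>I\<^sup>k\<close> and of \<open>\<mm>I\<^sup>k\<close>.  The next lemmas show, by
comparing degrees, that \<open>S k + UNIV\<close> is the disjoint union of \<open>S k\<close> and \<open>N k\<close>.
\<close>

abbreviation S :: "nat \<Rightarrow> ('n \<Rightarrow>\<^sub>0 nat) set" where "S \<equiv> sumset_power A"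

abbreviation N :: "nat \<Rightarrow> ('n \<Rightarrow>\<^sub>0 nat) set" where "N k \<equiv> - {0} + (S k + UNIV)"

lemma degree_S: "b \<in> S k \<Longrightarrow> mon_degree b = d * k"
  by (induction k arbitrary: b) (auto simp: set_plus_def mon_degree_add degree_generator)

lemma not_in_N_if_in_S: "b \<in> S k \<Longrightarrow> b \<notin> N k"
proof
  assume b: "b \<in> S k" "b \<in> N k"
  then obtain u s t where "b = u + (s + t)" "s \<in> S k" "u \<noteq> 0"
    unfolding set_plus_def by blast
  then have "mon_degree u = 0" using degree_S[of s k] degree_S[of b k] b(1) by (simp add: mon_degree_add)
  then show False using \<open>u \<noteq> 0\<close> by (simp add: mon_degree_eq_0_iff)
qed

lemma in_N_if_not_in_S: "b \<in> S k + UNIV \<Longrightarrow> b \<notin> S k \<Longrightarrow> b \<in> N k"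
proof -
  assume b: "b \<in> S k + UNIV" "b \<notin> S k"
  then obtain s t where st: "b = s + t" "s \<in> S k" by (auto elim: set_plus_elim)
  then have "t \<noteq> 0" using b(2) by auto
  then have "t + (s + 0) \<in> N k" using st by (intro set_plus_intro) auto
  then show "b \<in> N k" by (simp add: st add.commute)
qed

lemma N_subset: "N k \<subseteq> S k + UNIV"
proof -
  have "N k \<subseteq> UNIV + (S k + UNIV)" by (intro set_plus_mono2) auto
  also have "\<dots> = S k + UNIV" by (simp add: add.left_commute[of UNIV])
  finally show ?thesis .
qed

lemma S_add_UNIV: "(S i + UNIV) + (S j + UNIV) = S (i + j) + UNIV"
proof -
  have "(S i + UNIV) + (S j + UNIV) = S i + S j + (UNIV + UNIV)"
    by (simp only: add.assoc add.commute add.left_commute)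
  then show ?thesis by (simp add: sumset_power_add)
qed

lemma S_add_N: "(S i + UNIV) + N j = N (i + j)"
  by (subst add.left_commute) (simp only: S_add_UNIV)

lemma ideal_power_I: "ideal_power I k = monomial_span (S k + UNIV)"
  using I_eq by (rule ideal_power_eq)

lemma max_ideal_times_power: "max_ideal \<cdot>\<^bsub>mpoly_ring\<^esub> ideal_power I k = monomial_span (N k)"
  by (simp add: max_ideal_eq ideal_power_I ideal_prod_monomial_span)

lemma carrier_rees: "carrier (rees_ring I) = {p. \<forall>k. Polynomial.coeff p k \<in> monomial_span (S k + UNIV)}"
  by (simp add: rees_ring_def ideal_power_I)

lemma rees_simps [simp]:
  "x \<otimes>\<^bsub>rees_ring I\<^esub> y = x * y" "x \<oplus>\<^bsub>rees_ring I\<^esub> y = x + y"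
  "\<one>\<^bsub>rees_ring I\<^esub> = 1" "\<zero>\<^bsub>rees_ring I\<^esub> = 0"
  by (simp_all add: rees_ring_def)

lemma fiber_ideal_I: "fiber_ideal I = {p. \<forall>k. Polynomial.coeff p k \<in> monomial_span (N k)}"
  by (simp add: fiber_ideal_def max_ideal_times_power)

lemma fiber_ideal_subset: "fiber_ideal I \<subseteq> carrier (rees_ring I)"
  using monomial_span_mono[OF N_subset] by (auto simp: fiber_ideal_I carrier_rees)

lemma monom_in_rees: "f \<in> monomial_span (S k + UNIV) \<Longrightarrow> Polynomial.monom f k \<in> carrier (rees_ring I)"
  by (auto simp: carrier_rees)

lemma monom_in_fiber_ideal_iff: "Polynomial.monom f k \<in> fiber_ideal I \<longleftrightarrow> f \<in> monomial_span (N k)"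
  by (auto simp: fiber_ideal_I)

lemma one_in_rees: "1 \<in> carrier (rees_ring I)"
  using monom_in_rees[of 1 0] by (simp add: monomial_span_def one_pCons monom_0)

lemma rees_add_closed:
  "p \<in> carrier (rees_ring I) \<Longrightarrow> q \<in> carrier (rees_ring I) \<Longrightarrow> p + q \<in> carrier (rees_ring I)"
  by (simp add: carrier_rees monomial_span_add)

lemma rees_mult_closed:
  "p \<in> carrier (rees_ring I) \<Longrightarrow> q \<in> carrier (rees_ring I) \<Longrightarrow> p * q \<in> carrier (rees_ring I)"
  unfolding carrier_rees mem_Collect_eq
proof
  fix k
  assume p: "\<forall>k. Polynomial.coeff p k \<in> monomial_span (S k + UNIV)"
    and q: "\<forall>k. Polynomial.coeff q k \<in> monomial_span (S k + UNIV)"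
  have "Polynomial.coeff p i * Polynomial.coeff q (k - i) \<in> monomial_span (S k + UNIV)" if "i \<in> {..k}" for i
    using monomial_span_mult[OF p[rule_format, of i] q[rule_format, of "k - i"]] that
    by (simp only: S_add_UNIV le_add_diff_inverse atMost_iff)
  then show "Polynomial.coeff (p * q) k \<in> monomial_span (S k + UNIV)"
    unfolding coeff_mult by (rule monomial_span_sum)
qed

lemma fiber_ideal_add_closed:
  "p \<in> fiber_ideal I \<Longrightarrow> q \<in> fiber_ideal I \<Longrightarrow> p + q \<in> fiber_ideal I"
  by (simp add: fiber_ideal_I monomial_span_add)

lemma fiber_ideal_mult_closed:
  "p \<in> carrier (rees_ring I) \<Longrightarrow> q \<in> fiber_ideal I \<Longrightarrow> p * q \<in> fiber_ideal I"
  unfolding carrier_rees fiber_ideal_I mem_Collect_eq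
proof
  fix k
  assume p: "\<forall>k. Polynomial.coeff p k \<in> monomial_span (S k + UNIV)"
    and q: "\<forall>k. Polynomial.coeff q k \<in> monomial_span (N k)"
  have "Polynomial.coeff p i * Polynomial.coeff q (k - i) \<in> monomial_span (N k)" if "i \<in> {..k}" for i
    using monomial_span_mult[OF p[rule_format, of i] q[rule_format, of "k - i"]] that
    by (simp only: S_add_N le_add_diff_inverse atMost_iff)
  then show "Polynomial.coeff (p * q) k \<in> monomial_span (N k)"
    unfolding coeff_mult by (rule monomial_span_sum)
qed

lemma rees_uminus_closed:
  "p \<in> carrier (rees_ring I) \<Longrightarrow> - p \<in> carrier (rees_ring I)"
  by (simp add: carrier_rees monomial_span_def keys_uminus)

lemma fiber_ideal_uminus_closed:
  "p \<in> fiber_ideal I \<Longrightarrow> - p \<in> fiber_ideal I"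
  by (simp add: fiber_ideal_I monomial_span_def keys_uminus)

lemma cring_rees: "cring (rees_ring I)"
proof -
  interpret T: cring "ring_of_type_algebra :: ('n, 'a) mpoly poly ring" by (rule cring_from_type_algebra)
  have "subring (carrier (rees_ring I)) (ring_of_type_algebra :: ('n, 'a) mpoly poly ring)"
    by (rule T.subringI)
       (simp_all add: one_in_rees rees_add_closed rees_mult_closed rees_uminus_closed)
  then have "subcring (carrier (rees_ring I)) (ring_of_type_algebra :: ('n, 'a) mpoly poly ring)"
    by (rule T.subcringI')
  then show ?thesis
    using T.subcring_iff[of "carrier (rees_ring I)"] by (simp add: rees_ring_def)
qed

sublocale rees: cring "rees_ring I" by (rule cring_rees)

lemma rees_a_inv: "p \<in> carrier (rees_ring I) \<Longrightarrow> \<ominus>\<^bsub>rees_ring I\<^esub> p = - p"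
  by (rule rees.minus_equality) (simp_all add: rees_uminus_closed)

lemma ideal_fiber_ideal: "ideal (fiber_ideal I) (rees_ring I)"
proof (rule idealI)
  show "a \<otimes>\<^bsub>rees_ring I\<^esub> x \<in> fiber_ideal I" if "a \<in> fiber_ideal I" "x \<in> carrier (rees_ring I)" for a x
    using fiber_ideal_mult_closed[OF that(2,1)] by (simp add: mult.commute)
  show "subgroup (fiber_ideal I) (add_monoid (rees_ring I))"
  proof (rule rees.add.subgroupI)
    show "fiber_ideal I \<noteq> {}" using monom_in_fiber_ideal_iff[of 0 0] by auto
    show "\<ominus>\<^bsub>rees_ring I\<^esub> p \<in> fiber_ideal I" if "p \<in> fiber_ideal I" for p
      using that fiber_ideal_subset by (auto simp: rees_a_inv fiber_ideal_uminus_closed)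
  qed (use fiber_ideal_subset fiber_ideal_add_closed in auto)
qed (simp_all add: rees.ring_axioms fiber_ideal_mult_closed)

sublocale fib: cring "fiber_ring I"
  unfolding fiber_ring_def using ideal_fiber_ideal cring_rees by (rule ideal.quotient_is_cring)

definition residue_class :: "('n, 'a) mpoly poly \<Rightarrow> ('n, 'a) mpoly poly set" where
  "residue_class p = fiber_ideal I +>\<^bsub>rees_ring I\<^esub> p"

sublocale residue_class: ring_hom_ring "rees_ring I" "fiber_ring I" residue_class
  unfolding residue_class_def[abs_def] fiber_ring_def
  using ideal_fiber_ideal by (rule ideal.rcos_ring_hom_ring)

lemma residue_class_eq_iff:
  assumes "p \<in> carrier (rees_ring I)" "q \<in> carrier (rees_ring I)"
  shows "residue_class p = residue_class q \<longleftrightarrow> p - q \<in> fiber_ideal I"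
  using rees.quotient_eq_iff_same_a_r_cos[OF ideal_fiber_ideal assms] assms
  by (simp add: residue_class_def a_minus_def rees_a_inv)

lemma carrier_fiber: "carrier (fiber_ring I) = residue_class ` carrier (rees_ring I)"
  by (auto simp: fiber_ring_def FactRing_def A_RCOSETS_def' residue_class_def)

lemma one_not_in_fiber_ideal: "1 \<notin> fiber_ideal I"
  using monom_in_fiber_ideal_iff[of 1 0] not_in_N_if_in_S[of 0 0]
  by (auto simp: monomial_span_def one_pCons monom_0)

lemma const_in_rees: "Polynomial.monom (Poly_Mapping.single 0 c) 0 \<in> carrier (rees_ring I)"
  by (rule monom_in_rees) (simp add: monomial_span_def)

lemma subfield_fiber_scalars: "subfield (fiber_scalars I) (fiber_ring I)"
proof -
  define g where "g c = residue_class (Polynomial.monom (Poly_Mapping.single 0 c) 0)" for c :: 'a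
  interpret K: field "ring_of_type_algebra :: 'a ring" by (rule field_from_type_algebra)
  have "g \<in> ring_hom ring_of_type_algebra (fiber_ring I)"
  proof (rule ring_hom_memI)
    fix x y :: 'a
    show "g x \<in> carrier (fiber_ring I)"
      unfolding g_def using const_in_rees by (rule residue_class.hom_closed)
    show "g (x \<otimes>\<^bsub>ring_of_type_algebra\<^esub> y) = g x \<otimes>\<^bsub>fiber_ring I\<^esub> g y"
      unfolding g_def by (simp add: const_in_rees mult_monom mult_single flip: residue_class.hom_mult)
    show "g (x \<oplus>\<^bsub>ring_of_type_algebra\<^esub> y) = g x \<oplus>\<^bsub>fiber_ring I\<^esub> g y"
      unfolding g_def by (simp add: const_in_rees add_monom single_add flip: residue_class.hom_add)
  next
    show "g \<one>\<^bsub>ring_of_type_algebra\<^esub> = \<one>\<^bsub>fiber_ring I\<^esub>"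
      unfolding g_def by (simp add: monom_0 flip: residue_class.hom_one one_pCons)
  qed
  then interpret g: ring_hom_ring "ring_of_type_algebra :: 'a ring" "fiber_ring I" g
    by (intro ring_hom_ringI2 K.ring_axioms fib.ring_axioms)
  have "\<one>\<^bsub>fiber_ring I\<^esub> \<noteq> \<zero>\<^bsub>fiber_ring I\<^esub>"
  proof
    assume "\<one>\<^bsub>fiber_ring I\<^esub> = \<zero>\<^bsub>fiber_ring I\<^esub>"
    then have "residue_class 1 = residue_class 0" using residue_class.hom_one residue_class.hom_zero by simp
    then have "1 - 0 \<in> fiber_ideal I"
      using rees.one_closed rees.zero_closed by (subst (asm) residue_class_eq_iff) simp_all
    then show False using one_not_in_fiber_ideal by simp
  qed
  then have "subfield (g ` carrier ring_of_type_algebra) (fiber_ring I)"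
    by (intro g.img_is_subfield(2) K.carrier_is_subfield)
  also have "g ` carrier ring_of_type_algebra = fiber_scalars I"
    by (simp add: fiber_scalars_def g_def[abs_def] residue_class_def)
  finally show ?thesis .
qed

text \<open>
The classes of the monomials with exponents in \<open>T\<close> are added one at a time.  The class of the
monomial \<open>b\<close> is not in the span of the earlier ones, because a difference in \<open>\<mm>I\<^sup>k\<close> cannot involve
the exponent \<open>b \<in> S k\<close>.
\<close>

lemma dimension_monomials:
  assumes "finite T" "T \<subseteq> S k"
  shows "fib.dimension (card T) (fiber_scalars I)
    ((\<lambda>f. residue_class (Polynomial.monom f k)) ` monomial_span T)"
  using assms
proof (induction T rule: finite_induct)
  case empty
  have "monomial_span {} = {0 :: ('n, 'a) mpoly}" by (auto simp: monomial_span_def)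
  moreover have "residue_class 0 = \<zero>\<^bsub>fiber_ring I\<^esub>" using residue_class.hom_zero by simp
  ultimately show ?case using fib.zero_dim by simp
next
  case (insert b T)
  let ?E = "\<lambda>T. (\<lambda>f. residue_class (Polynomial.monom f k)) ` monomial_span T"
  let ?v = "residue_class (Polynomial.monom (monomial b) k)"
  have T_rees: "Polynomial.monom f k \<in> carrier (rees_ring I)" if "f \<in> monomial_span U" "U \<subseteq> S k" for f U
  proof (rule monom_in_rees)
    have "U \<subseteq> S k + UNIV" using that(2) set_plus_intro[of _ "S k" 0 UNIV] by auto
    then show "f \<in> monomial_span (S k + UNIV)" using that(1) monomial_span_mono by blast
  qed
  have b_rees: "Polynomial.monom (Poly_Mapping.single b c) k \<in> carrier (rees_ring I)" for c
    using insert.prems by (intro T_rees[of _ "{b}"]) (auto simp: monomial_span_def)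
  have "?v \<notin> ?E T"
  proof
    assume "?v \<in> ?E T"
    then obtain f where f: "f \<in> monomial_span T" "?v = residue_class (Polynomial.monom f k)" by auto
    then have "Polynomial.monom (monomial b - f) k \<in> fiber_ideal I"
      using b_rees[of 1] T_rees[of f T] insert.prems
      by (simp add: residue_class_eq_iff monomial_def flip: diff_monom)
    then have "monomial b - f \<in> monomial_span (N k)" by (simp add: monom_in_fiber_ideal_iff)
    moreover have "b \<in> Poly_Mapping.keys (monomial b - f)"
    proof -
      have "Poly_Mapping.lookup f b = 0" using f(1) insert.hyps by (auto simp: monomial_span_def in_keys_iff)
      then show ?thesis by (simp add: in_keys_iff lookup_minus monomial_def)
    qed
    ultimately have "b \<in> N k" by (auto simp: monomial_span_def)
    then show False using not_in_N_if_in_S insert.prems by auto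
  qed
  moreover have "?v \<in> carrier (fiber_ring I)"
    unfolding monomial_def using b_rees by (rule residue_class.hom_closed)
  moreover have "fib.dimension (card T) (fiber_scalars I) (?E T)"
    using insert by simp
  ultimately have "fib.dimension (Suc (card T)) (fiber_scalars I) (fib.line_extension (fiber_scalars I) ?v (?E T))"
    by (intro fib.Suc_dim)
  also have "fib.line_extension (fiber_scalars I) ?v (?E T) = ?E (insert b T)"
  proof -
    have comb: "residue_class (Polynomial.monom (Poly_Mapping.single 0 c) 0) \<otimes>\<^bsub>fiber_ring I\<^esub> ?v \<oplus>\<^bsub>fiber_ring I\<^esub> residue_class (Polynomial.monom f k)
        = residue_class (Polynomial.monom (Poly_Mapping.single b c + f) k)" if "f \<in> monomial_span T" for c f
    proof -
      have "residue_class (Polynomial.monom (Poly_Mapping.single 0 c) 0) \<otimes>\<^bsub>fiber_ring I\<^esub> ?v = residue_class (Polynomial.monom (Poly_Mapping.single b c) k)"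
        using const_in_rees[of c] b_rees[of 1]
        by (simp add: monomial_def mult_monom mult_single flip: residue_class.hom_mult)
      then show ?thesis
        using b_rees[of c] T_rees[OF that] insert.prems by (simp add: add_monom flip: residue_class.hom_add)
    qed
    show ?thesis
    proof (intro equalityI subsetI)
      fix u assume "u \<in> fib.line_extension (fiber_scalars I) ?v (?E T)"
      then obtain c f where f: "f \<in> monomial_span T" and
        u: "u = residue_class (Polynomial.monom (Poly_Mapping.single 0 c) 0) \<otimes>\<^bsub>fiber_ring I\<^esub> ?v \<oplus>\<^bsub>fiber_ring I\<^esub> residue_class (Polynomial.monom f k)"
        unfolding fib.line_extension_mem_iff fiber_scalars_def residue_class_def by blast
      have "Poly_Mapping.single b c + f \<in> monomial_span (insert b T)"
        using f monomial_span_mono[of T "insert b T"]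
        by (intro monomial_span_add) (auto simp: monomial_span_def)
      then show "u \<in> ?E (insert b T)" unfolding u comb[OF f] by blast
    next
      fix u assume "u \<in> ?E (insert b T)"
      then obtain f where f: "f \<in> monomial_span (insert b T)" "u = residue_class (Polynomial.monom f k)" by auto
      define c where "c = Poly_Mapping.lookup f b"
      have "f - Poly_Mapping.single b c \<in> monomial_span T"
        using f(1) by (auto simp: monomial_span_def in_keys_iff lookup_minus lookup_single c_def when_def split: if_splits)
      then show "u \<in> fib.line_extension (fiber_scalars I) ?v (?E T)"
        unfolding fib.line_extension_mem_iff fiber_scalars_def residue_class_def[symmetric]
        using comb[of "f - Poly_Mapping.single b c" c] f(2)
        by (intro bexI[of _ "residue_class (Polynomial.monom (Poly_Mapping.single 0 c) 0)"]
              bexI[of _ "residue_class (Polynomial.monom (f - Poly_Mapping.single b c) k)"]) simp_all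
    qed
  qed
  finally show ?case using insert.hyps by simp
qed

text \<open>
The terms of an element of \<open>I\<^sup>k\<close> whose exponents are outside \<open>S k\<close> vanish in the fiber ring.
\<close>

lemma fiber_component_eq:
  "fiber_component I k = (\<lambda>f. residue_class (Polynomial.monom f k)) ` monomial_span (S k)"
proof (intro equalityI subsetI)
  have sub: "monomial_span (S k) \<subseteq> (monomial_span (S k + UNIV) :: ('n, 'a) mpoly set)"
    using set_plus_intro[of _ "S k" 0 UNIV] by (intro monomial_span_mono) auto
  {
    fix u assume "u \<in> fiber_component I k"
    then obtain f where f: "f \<in> monomial_span (S k + UNIV)" "u = residue_class (Polynomial.monom f k)"
      by (auto simp: fiber_component_def ideal_power_I residue_class_def)
    define g where "g = (\<Sum>a\<in>Poly_Mapping.keys f \<inter> S k. Poly_Mapping.single a (Poly_Mapping.lookup f a))"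
    have g: "Poly_Mapping.lookup g b = (if b \<in> S k then Poly_Mapping.lookup f b else 0)" for b
      by (auto simp: g_def lookup_sum lookup_single when_def in_keys_iff)
    have "g \<in> monomial_span (S k)" by (auto simp: monomial_span_def in_keys_iff g split: if_splits)
    moreover have "f - g \<in> monomial_span (N k)"
    proof (rule monomial_spanI)
      fix b assume "b \<in> Poly_Mapping.keys (f - g)"
      then have "b \<notin> S k" "b \<in> Poly_Mapping.keys f"
        by (auto simp: in_keys_iff lookup_minus g split: if_splits)
      then show "b \<in> N k" using f(1) in_N_if_not_in_S by (auto simp: monomial_span_def)
    qed
    ultimately have "residue_class (Polynomial.monom f k) = residue_class (Polynomial.monom g k)"
      using f(1) sub monom_in_rees by (subst residue_class_eq_iff) (auto simp: diff_monom monom_in_fiber_ideal_iff)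
    then show "u \<in> (\<lambda>f. residue_class (Polynomial.monom f k)) ` monomial_span (S k)"
      using f(2) \<open>g \<in> monomial_span (S k)\<close> by blast
  next
    fix u assume "u \<in> (\<lambda>f. residue_class (Polynomial.monom f k)) ` monomial_span (S k)"
    then show "u \<in> fiber_component I k"
      using sub by (auto simp: fiber_component_def ideal_power_I residue_class_def)
  }
qed

lemma hilbert_function_eq:
  assumes "finite A"
  shows "hilbert_function I k = card (S k)"
proof -
  have "fib.dimension (card (S k)) (fiber_scalars I) (fiber_component I k)"
    unfolding fiber_component_eq
    using finite_sumset_power[OF assms] by (intro dimension_monomials) auto
  then show ?thesis
    unfolding hilbert_function_def using fib.dimI[OF subfield_fiber_scalars] by (simp add: over_def)
qed

end

section \<open>The analytic spread is at most the rank\<close>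

definition exponent_vector :: "('n::finite \<Rightarrow>\<^sub>0 nat) \<Rightarrow> real ^ 'n" where
  "exponent_vector b = (\<chi> i. real (Poly_Mapping.lookup b i))"

lemma exponent_vector_0 [simp]: "exponent_vector 0 = 0"
  by (simp add: exponent_vector_def vec_eq_iff)

lemma exponent_vector_add: "exponent_vector (a + b) = exponent_vector a + exponent_vector b"
  by (simp add: exponent_vector_def vec_eq_iff lookup_add)

lemma exponent_vector_nth [simp]: "exponent_vector b $ i = real (Poly_Mapping.lookup b i)"
  by (simp add: exponent_vector_def)

lemma inj_exponent_vector: "inj exponent_vector"
  by (rule injI) (auto simp: vec_eq_iff intro!: poly_mapping_eqI)

lemma lookup_le_mon_degree: "Poly_Mapping.lookup b i \<le> mon_degree b"
  unfolding mon_degree_def by (rule member_le_sum) auto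

lemma finite_bounded_mon_degree: "finite {b :: 'n::finite \<Rightarrow>\<^sub>0 nat. mon_degree b \<le> m}"
proof (rule inj_on_finite)
  show "inj_on Poly_Mapping.lookup {b :: 'n \<Rightarrow>\<^sub>0 nat. mon_degree b \<le> m}"
    by (rule inj_onI) (auto intro: poly_mapping_eqI)
  show "Poly_Mapping.lookup ` {b :: 'n \<Rightarrow>\<^sub>0 nat. mon_degree b \<le> m} \<subseteq> PiE UNIV (\<lambda>_. {..m})"
    by (auto intro: le_trans[OF lookup_le_mon_degree])
qed (auto intro: finite_PiE)

context equigenerated
begin

definition rank :: nat where "rank = dim (exponent_vector ` A)"

lemma finite_A: "finite A"
  by (rule finite_subset[OF _ finite_bounded_mon_degree[of d]]) (auto simp: degree_generator)

lemma finite_S: "finite (S k)"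
  using finite_A by (rule finite_sumset_power)

lemma exponent_vector_S_span: "b \<in> S k \<Longrightarrow> exponent_vector b \<in> span (exponent_vector ` A)"
proof (induction k arbitrary: b)
  case (Suc k)
  then obtain a c where "b = a + c" "a \<in> S k" "c \<in> A" by (auto elim: set_plus_elim)
  then show ?case using Suc.IH[of a] by (simp add: exponent_vector_add span_add span_base)
qed (simp add: span_zero)

text \<open>
A pair \<open>(k, b)\<close> is determined by \<open>b\<close>, since \<open>d k\<close> is the degree of \<open>b\<close>, and \<open>b\<close> is determined by at
most \<open>rank\<close> of its coordinates, each of which is at most \<open>d m\<close>.
\<close>

lemma card_graded_exponents_le:
  assumes "d > 0"
  shows "card (SIGMA k:{..m}. S k) \<le> Suc (d * m) ^ rank"
proof -
  obtain J where J: "card J \<le> dim (span (exponent_vector ` A))"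
    "\<And>x. x \<in> span (exponent_vector ` A) \<Longrightarrow> (\<And>j. j \<in> J \<Longrightarrow> x $ j = 0) \<Longrightarrow> x = 0"
    using coordinates_determining_subspace[OF subspace_span] by blast
  define g where "g = (\<lambda>(k :: nat, b :: 'n \<Rightarrow>\<^sub>0 nat). restrict (Poly_Mapping.lookup b) J)"
  have "card (SIGMA k:{..m}. S k) \<le> card (PiE J (\<lambda>_. {..d * m}))"
  proof (rule card_inj_on_le)
    show "inj_on g (SIGMA k:{..m}. S k)"
    proof (rule inj_onI)
      fix p q assume pq: "p \<in> (SIGMA k:{..m}. S k)" "q \<in> (SIGMA k:{..m}. S k)" "g p = g q"
      obtain k a l b where [simp]: "p = (k, a)" "q = (l, b)" by (cases p, cases q)
      have mem: "a \<in> S k" "b \<in> S l" using pq by auto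
      have "Poly_Mapping.lookup a j = Poly_Mapping.lookup b j" if "j \<in> J" for j
        using fun_cong[OF pq(3), of j] that by (simp add: g_def)
      then have "exponent_vector a - exponent_vector b = 0"
        using mem by (intro J(2) span_diff exponent_vector_S_span) auto
      then have "a = b" by (simp add: injD[OF inj_exponent_vector])
      then have "d * k = d * l" using mem degree_S by metis
      then show "p = q" using \<open>a = b\<close> assms by simp
    qed
    show "g ` (SIGMA k:{..m}. S k) \<subseteq> PiE J (\<lambda>_. {..d * m})"
    proof -
      have "Poly_Mapping.lookup b j \<le> d * m" if "b \<in> S k" "k \<le> m" for b k j
        using lookup_le_mon_degree[of b j] degree_S[OF that(1)] that(2) mult_le_mono2[of k m d] by linarith
      then show ?thesis by (auto simp: g_def)
    qed
  qed (simp add: finite_PiE)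
  also have "\<dots> = Suc (d * m) ^ card J" by (simp add: card_PiE)
  also have "\<dots> \<le> Suc (d * m) ^ rank"
    using J(1) by (intro power_increasing) (auto simp: rank_def)
  finally show ?thesis .
qed

lemma rees_power_product_closed:
  assumes "\<And>i. i < length es \<Longrightarrow> x i \<in> carrier (rees_ring I)"
  shows "power_product x es \<in> carrier (rees_ring I)"
proof -
  have pow: "p ^ n \<in> carrier (rees_ring I)" if "p \<in> carrier (rees_ring I)" for p n
    using that by (induction n) (auto intro: rees_mult_closed one_in_rees)
  have "(\<Prod>i\<in>W. x i ^ (es ! i)) \<in> carrier (rees_ring I)" if "finite W" "W \<subseteq> {..<length es}" for W
    using that by (induction W rule: finite_induct) (auto intro: rees_mult_closed one_in_rees pow assms)
  then show ?thesis by (simp add: power_product_def)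
qed

lemma degree_power_product_le:
  assumes "es \<in> exponent_lists D k" and "\<And>i. i < D \<Longrightarrow> Polynomial.degree (x i) \<le> m"
  shows "Polynomial.degree (power_product x es) \<le> D * (m * k)"
proof -
  have es: "length es = D" "\<And>i. i < D \<Longrightarrow> es ! i \<le> k"
    using assms(1) nth_mem[of _ es] unfolding exponent_lists_def by (fastforce simp del: nth_mem)+
  have "Polynomial.degree (power_product x es) \<le> (\<Sum>i<D. Polynomial.degree (x i ^ (es ! i)))"
    unfolding power_product_def es(1) using degree_prod_sum_le[of "{..<D}" "\<lambda>i. x i ^ (es ! i)"] by (simp add: o_def)
  also have "\<dots> \<le> (\<Sum>i<D. m * k)"
  proof (rule sum_mono)
    fix i assume "i \<in> {..<D}"
    then have "Polynomial.degree (x i) * es ! i \<le> m * k" using assms(2) es(2) by (intro mult_le_mono) auto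
    then show "Polynomial.degree (x i ^ (es ! i)) \<le> m * k" using degree_power_le[of "x i" "es ! i"] by linarith
  qed
  finally show ?thesis by simp
qed

text \<open>
The chain is pulled back to the Rees ring.  An element of the Rees ring of degree at most \<open>j\<close> lies in
the fiber ideal as soon as its coefficients at the exponents counted in \<open>card_graded_exponents_le\<close>
vanish.  If there were more power products than such exponents, a nontrivial combination of them
would lie in the fiber ideal, hence in the smallest prime, contradicting their independence.
\<close>

lemma chain_growth_bound:
  assumes "d > 0"
    and prime: "\<And>i. i \<le> D \<Longrightarrow> primeideal (P i) (fiber_ring I)"
    and chain: "\<And>i. i < D \<Longrightarrow> P i \<subset> P (Suc i)"
  shows "\<exists>m. \<forall>k. Suc k ^ D \<le> Suc (m * k) ^ rank"
proof -
  define Q where "Q i = {p \<in> carrier (rees_ring I). residue_class p \<in> P i}" for i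
  have Q_prime: "primeideal (Q i) (rees_ring I)" if "i \<le> D" for i
    unfolding Q_def using cring_rees prime[OF that] by (rule residue_class.primeideal_vimage)
  have "\<exists>p. p \<in> Q (Suc i) - Q i" if "i < D" for i
  proof -
    have "P i \<subset> P (Suc i)" using that by (rule chain)
    then obtain u where u: "u \<in> P (Suc i)" "u \<notin> P i" by blast
    interpret primeideal "P (Suc i)" "fiber_ring I" using prime that by simp
    have "u \<in> carrier (fiber_ring I)" using u(1) a_subset by blast
    then show ?thesis using u by (auto simp: carrier_fiber Q_def)
  qed
  then obtain x where x: "\<And>i. i < D \<Longrightarrow> x i \<in> Q (Suc i) - Q i" by metis
  have Q_chain: "Q i \<subseteq> Q (Suc i)" if "i < D" for i using chain[OF that] by (auto simp: Q_def)
  have x_rees: "x i \<in> carrier (rees_ring I)" if "i < D" for i using x[OF that] by (simp add: Q_def)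
  have fiber_Q0: "fiber_ideal I \<subseteq> Q 0"
  proof
    fix p assume p: "p \<in> fiber_ideal I"
    then have pr: "p \<in> carrier (rees_ring I)" using fiber_ideal_subset by blast
    interpret primeideal "P 0" "fiber_ring I" using prime by simp
    have "residue_class p = residue_class 0" using p pr rees.zero_closed by (simp add: residue_class_eq_iff)
    then show "p \<in> Q 0" using pr zero_closed residue_class.hom_zero by (simp add: Q_def)
  qed
  define const :: "'a \<Rightarrow> ('n, 'a) mpoly poly" where "const c = Polynomial.monom (Poly_Mapping.single 0 c) 0" for c
  have const_QD: "c = 0" if "const c \<in> Q D" for c
  proof (rule ccontr)
    assume "c \<noteq> 0"
    interpret primeideal "Q D" "rees_ring I" using Q_prime by simp
    have "const (inverse c) * const c \<in> Q D"
      using I_l_closed[OF that, of "const (inverse c)"] const_in_rees by (simp add: const_def)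
    moreover have "const (inverse c) * const c = 1"
      using \<open>c \<noteq> 0\<close> by (simp add: const_def mult_monom mult_single monom_0)
    ultimately show False using I_notcarr one_imp_carrier by simp
  qed
  define M where "M = (\<Sum>i<D. Polynomial.degree (x i))"
  have M: "Polynomial.degree (x i) \<le> M" if "i < D" for i
    unfolding M_def using that by (intro member_le_sum) auto
  \<comment> \<open>The power products have degree \<open>j \<le> D M k\<close> in the Rees variable, and for such \<open>j\<close> the entries of vectors in \<open>S j\<close> are at most \<open>d D M k\<close>.\<close>
  have "Suc k ^ D \<le> Suc (d * (D * M) * k) ^ rank" for k
  proof (rule ccontr)
    assume "\<not> Suc k ^ D \<le> Suc (d * (D * M) * k) ^ rank"
    then have gt: "Suc (d * (D * (M * k))) ^ rank < card (exponent_lists D k)"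
      by (simp add: card_exponent_lists mult.assoc)
    define B where "B = (SIGMA j:{..D * (M * k)}. S j)"
    define f where "f es p = Poly_Mapping.lookup (Polynomial.coeff (power_product x es) (fst p)) (snd p)" for es p
    have lt: "card B < card (exponent_lists D k)"
      unfolding B_def using card_graded_exponents_le[OF assms(1)] gt by (rule le_less_trans)
    have "finite B" unfolding B_def using finite_S by (intro finite_SigmaI) auto
    then obtain c where c: "\<exists>es\<in>exponent_lists D k. c es \<noteq> 0"
      "\<And>p. p \<in> B \<Longrightarrow> (\<Sum>es\<in>exponent_lists D k. c es * f es p) = 0"
      using homogeneous_system_nontrivial_solution[OF _ finite_exponent_lists lt, where f = f] by blast
    define y where "y = (\<Sum>es\<in>exponent_lists D k. const (c es) * power_product x es)"
    have coeff_y: "Poly_Mapping.lookup (Polynomial.coeff y j) b =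
        (\<Sum>es\<in>exponent_lists D k. c es * Poly_Mapping.lookup (Polynomial.coeff (power_product x es) j) b)" for j b
      by (simp add: y_def coeff_sum lookup_sum const_def monom_0 lookup_const_mult)
    have pp_rees: "power_product x es \<in> carrier (rees_ring I)" if "es \<in> exponent_lists D k" for es
      using that x_rees by (intro rees_power_product_closed) (auto simp: exponent_lists_def)
    have "y \<in> carrier (rees_ring I)"
      unfolding y_def carrier_rees mem_Collect_eq
    proof
      fix j
      have "Polynomial.coeff (const (c es) * power_product x es) j \<in> monomial_span (S j + UNIV)"
        if "es \<in> exponent_lists D k" for es
        using rees_mult_closed[OF const_in_rees pp_rees[OF that], of "c es"]
        unfolding carrier_rees const_def by blast
      then show "Polynomial.coeff (\<Sum>es\<in>exponent_lists D k. const (c es) * power_product x es) j \<in> monomial_span (S j + UNIV)"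
        unfolding coeff_sum by (rule monomial_span_sum)
    qed
    moreover have "Poly_Mapping.lookup (Polynomial.coeff y j) b = 0" if "b \<in> S j" for j b
    proof (cases "j \<le> D * (M * k)")
      case True
      then show ?thesis using c(2)[of "(j, b)"] that by (simp add: coeff_y B_def f_def)
    next
      case False
      then have "Polynomial.coeff (power_product x es) j = 0" if "es \<in> exponent_lists D k" for es
        using degree_power_product_le[OF that, of x M] M by (intro coeff_eq_0) auto
      then show ?thesis by (simp add: coeff_y)
    qed
    ultimately have "y \<in> fiber_ideal I"
      unfolding fiber_ideal_I carrier_rees monomial_span_def using in_N_if_not_in_S
      by (fastforce simp: in_keys_iff)
    then have "y \<in> Q 0" using fiber_Q0 by blast
    have R: "rees_ring I = ring_of_type_algebra \<lparr>carrier := carrier (rees_ring I)\<rparr>"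
      by (simp add: rees_ring_def)
    have "const (c es) = 0" if "es \<in> exponent_lists D k" for es
    proof (rule independent_mod_prime_chain[where c = "\<lambda>es. const (c es)" and P = Q and x = x
          and C = "carrier (rees_ring I)", unfolded R[symmetric]])
      show "const (c es) \<in> carrier (rees_ring I)" for es unfolding const_def by (rule const_in_rees)
      show "const (c es) = 0" if "const (c es) \<in> Q D" for es
        using const_QD[OF that] by (simp add: const_def)
      show "(\<Sum>es\<in>exponent_lists D k. const (c es) * power_product x es) \<in> Q 0"
        using \<open>y \<in> Q 0\<close> by (simp add: y_def)
    qed (use Q_prime Q_chain x that in auto)
    then have "c es = 0" if "es \<in> exponent_lists D k" for es
      using that by (metis const_def lookup_single_eq lookup_zero monom_eq_0_iff)
    then show False using c(1) by blast
  qed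
  then show ?thesis by blast
qed

lemma analytic_spread_le_rank:
  assumes "d > 0"
  shows "analytic_spread I \<le> rank"
proof -
  have "krull_dim (fiber_ring I) \<le> enat rank"
    unfolding krull_dim_def
  proof (rule SUP_least)
    fix D assume "D \<in> {D. \<exists>P :: nat \<Rightarrow> _ set. (\<forall>i\<le>D. primeideal (P i) (fiber_ring I)) \<and> (\<forall>i<D. P i \<subset> P (Suc i))}"
    then obtain P where "\<And>i. i \<le> D \<Longrightarrow> primeideal (P i) (fiber_ring I)" "\<And>i. i < D \<Longrightarrow> P i \<subset> P (Suc i)"
      by blast
    then obtain m where "\<And>k. Suc k ^ D \<le> Suc (m * k) ^ rank"
      using chain_growth_bound[OF assms] by blast
    then show "enat D \<le> enat rank" using power_growth_exponent_le[of D m rank] by simp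
  qed
  then show ?thesis unfolding analytic_spread_def by (cases "krull_dim (fiber_ring I)") auto
qed

lemma freiman_exponents: "rank * card A \<le> card (A + A) + (rank choose 2)"
proof -
  have inj: "inj_on exponent_vector W" for W :: "('n \<Rightarrow>\<^sub>0 nat) set" using inj_exponent_vector by (rule inj_on_subset) simp
  have "exponent_vector ` A + exponent_vector ` A = exponent_vector ` (A + A)"
    by (auto simp: set_plus_def exponent_vector_add image_iff) (metis exponent_vector_add)+
  then show ?thesis
    using freiman_lemma[of "exponent_vector ` A"] finite_A inj by (simp add: rank_def card_image)
qed

lemma rank_le_card: "rank \<le> card A"
  unfolding rank_def using dim_le_card'[of "exponent_vector ` A"] card_image_le[of A exponent_vector] finite_A by fastforce

end

section \<open>The second entry of the h-vector\<close>

lemma fps_nth_one_minus_X_power: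
  "fps_nth ((1 - fps_X :: int fps) ^ l) 0 = 1"
  "fps_nth ((1 - fps_X :: int fps) ^ l) 1 = - int l"
  "fps_nth ((1 - fps_X :: int fps) ^ l) 2 = int (l choose 2)"
proof (induction l)
  case (Suc l)
  {
    case 1 show ?case using Suc by (simp add: algebra_simps)
  next
    case 2 show ?case using Suc by (simp add: algebra_simps)
  next
    case 3 show ?case using Suc by (simp add: algebra_simps numeral_2_eq_2)
  }
qed (simp_all add: numeral_2_eq_2)

lemma h_vector_2:
  "h_vector I 2 = int (hilbert_function I 2) - int (analytic_spread I) * int (hilbert_function I 1)
     + int (analytic_spread I choose 2) * int (hilbert_function I 0)"
proof -
  have "{0..2} = {0, 1, 2 :: nat}" by auto
  then show ?thesis
    by (simp add: h_vector_def fps_mult_nth fps_nth_one_minus_X_power hilbert_series_def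
        fps_nth_one_minus_X_power(2)[unfolded One_nat_def])
qed

text \<open>
The step from \<open>n\<close> to \<open>n + 1\<close> adds \<open>n\<close> to the binomial coefficient and \<open>m \<ge> n\<close> to the product.
\<close>

lemma freiman_defect_antimono:
  assumes "l \<le> r" and "r \<le> (m :: nat)"
  shows "(r choose 2) + l * m \<le> (l choose 2) + r * m"
  using assms
proof (induction rule: dec_induct)
  case (step n)
  have "(Suc n choose 2) = (n choose 2) + n" by (simp add: numeral_2_eq_2)
  then show ?case using step by simp
qed simp

lemma equigenerated_monomial_idealE:
  fixes I :: "('n::finite, 'a::field) mpoly set"
  assumes "equigenerated_monomial_ideal I" and "I \<noteq> UNIV"
  obtains A d where "equigenerated A d I" "d > 0"
proof -
  obtain d A where A: "\<forall>a\<in>A. mon_degree a = d" and I: "I = monomial_span (A + UNIV)"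
    using assms(1) unfolding equigenerated_monomial_ideal_def genideal_monomials by blast
  show thesis
  proof (cases "A = {}")
    case True
    then show thesis using that[of A 1] I by (simp add: equigenerated_def)
  next
    case False
    have "d \<noteq> 0"
    proof
      assume "d = 0"
      then have "A = {0}" using A False by (auto simp: mon_degree_eq_0_iff)
      then show False using I assms(2) by simp
    qed
    then show thesis using that[of A d] A I by (simp add: equigenerated_def)
  qed
qed

theorem corollary2p6:
  fixes I :: "('n::finite, 'a::field) mpoly set"
  assumes "equigenerated_monomial_ideal I"
    and "I \<noteq> UNIV"
  shows "h_vector I 2 \<ge> 0"
proof -
  obtain A d where "equigenerated A d I" and "d > 0"
    using equigenerated_monomial_idealE[OF assms] .
  then interpret equigenerated A d I by simp
  have H: "hilbert_function I 0 = 1" "hilbert_function I 1 = card A" "hilbert_function I 2 = card (A + A)"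
    using hilbert_function_eq[OF finite_A] by (simp_all add: numeral_2_eq_2)
  have "analytic_spread I * card A \<le> card (A + A) + (analytic_spread I choose 2)"
    using freiman_defect_antimono[OF analytic_spread_le_rank[OF \<open>d > 0\<close>] rank_le_card] freiman_exponents
    by linarith
  then have "int (analytic_spread I * card A) \<le> int (card (A + A) + (analytic_spread I choose 2))"
    by (simp only: of_nat_le_iff)
  then show ?thesis by (simp add: h_vector_2 H del: One_nat_def)
qed

end
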